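(* Let $m$ be a squarefree positive integer, let $n$ denote the number of odd prime divisors of $m$, and let $A\subset\mathbb{Z}_m$ be a set such that $A-A$ does not contain non-zero squares. Then $$|A|\leq m^{1/2}(3n)^{1.5n}.$$
   Context: $\mathbb{Z}_m=\mathbb{Z}/m\mathbb{Z}$ is the ring of residues modulo $m$. An element $x\in\mathbb{Z}_m$ is a square if $x=y^2$ for some $y\in\mathbb{Z}_m$ ($y$ need not be invertible). $A-A=\{a-b: a,b\in A\}$. The condition on $A$ means that for all distinct $a,b\in A$ the element $a-b$ is not a square in $\mathbb{Z}_m$. When $n=0$ the quantity $(3n)^{1.5n}$ is read as $0^0=1$. *)

theory Defs
  imports
    Complex_Main
    "HOL-Number_Theory.Number_Theory"
    "HOL-Computational_Algebra.Squarefree"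
begin

definition diff_set :: "('a, 'b) ring_scheme \<Rightarrow> 'a set \<Rightarrow> 'a set"
  where "diff_set R A = {a \<ominus>\<^bsub>R\<^esub> b | a b. a \<in> A \<and> b \<in> A}"

definition square_in :: "('a, 'b) ring_scheme \<Rightarrow> 'a \<Rightarrow> bool"
  where "square_in R x \<longleftrightarrow> (\<exists>y\<in>carrier R. x = y \<otimes>\<^bsub>R\<^esub> y)"

(* residue_ring 1 has carrier {0} but unit 1, so it is not literally the zero ring; diff_set and
   square_in do not involve the unit, and subtraction is the expected one for every positive
   modulus: *)
lemma residue_ring_minus:
  fixes m a b :: int
  assumes "m > 0" and "a \<in> carrier (residue_ring m)" and "b \<in> carrier (residue_ring m)"
  shows "a \<ominus>\<^bsub>residue_ring m\<^esub> b = (a - b) mod m"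
proof (cases "m = 1")
  case True
  then show ?thesis
    by (simp add: a_minus_def residue_ring_def)
next
  case False
  with assms(1) interpret residues m "residue_ring m"
    by unfold_locales simp_all
  show ?thesis
    by (simp add: a_minus_def res_neg_eq res_add_eq mod_simps)
qed

definition num_odd_prime_divisors :: "nat \<Rightarrow> nat"
  where "num_odd_prime_divisors m = card {p. prime p \<and> odd p \<and> p dvd m}"

(* (3n)^(1.5n) with the convention 0^0 = 1; in the library 0 powr 0 = 0. *)
definition bound_factor :: "nat \<Rightarrow> real"
  where "bound_factor n = (if n = 0 then 1 else (3 * real n) powr (1.5 * real n))"

end

theory Submission
  imports Defs "HOL-Analysis.Infinite_Products" "HOL-Library.Real_Mod"
begin

text \<open>
  The proof is a Fourier-analytic (Delsarte, or Turan type) argument. Let \<open>P\<close> be the set of odd primes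
  dividing \<open>m\<close>, of size \<open>n\<close>. Suppose that a real function \<open>F\<close> of integers modulo \<open>m\<close> vanishes at all
  differences of distinct elements of \<open>A\<close> and that all its Fourier coefficients have nonnegative real
  part. Then \<open>\<Sum>a,b. F (a - b)\<close>, taken over \<open>A\<close>, equals \<open>|A| F 0\<close>; on the other hand it is the sum over
  the characters of the Fourier coefficient times a square modulus, and dropping all characters but
  the trivial one leaves \<open>|A|\<^sup>2\<close> times the mean of \<open>F\<close>. So \<open>|A|\<close> is at most \<open>F 0\<close> divided by that mean.

  Take \<open>F = \<Prod>p\<in>P. f\<^sub>p\<close> where \<open>f\<^sub>p x\<close> counts the square roots of \<open>x\<close> modulo \<open>p\<close>, increased by a constant
  \<open>c\<^sub>p\<close> at multiples of \<open>p\<close>. By the Chinese remainder theorem a nonsquare modulo the squarefree \<open>m\<close> is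
  a nonsquare modulo some prime divisor of \<open>m\<close>, which is odd since everything is a square modulo 2,
  so \<open>F\<close> vanishes there (\<open>exists_square_root_mod_squarefree\<close>). The Fourier coefficients of \<open>f\<^sub>p\<close> are
  \<open>(c\<^sub>p + S) / p\<close> with \<open>S\<close> a quadratic Gauss sum, which is \<open>p\<close> at the trivial character and has modulus
  \<open>sqrt p\<close> at the others (\<open>sqrt_weight_fourier\<close>, \<open>norm_quad_gauss_sum\<close>).

  For \<open>p\<close> congruent to 3 modulo 4 the nontrivial \<open>S\<close> are imaginary, so these coefficients are not real.
  With \<open>c\<^sub>p = 2 n sqrt p\<close>, however, each is a positive number times \<open>1 + w\<close> with \<open>|w| \<le> 1 / (2 n)\<close>, and
  a product of \<open>n\<close> such factors is within \<open>exp (1/2) - 1 \<le> 1\<close> of 1, hence has nonnegative real part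
  (\<open>Re_prod_nonneg\<close>). The quotient of \<open>F 0 = \<Prod>p\<in>P. (c\<^sub>p + 1)\<close> by the mean \<open>\<Prod>p\<in>P. (c\<^sub>p + p) / p\<close> is at
  most \<open>\<Prod>p\<in>P. 2 n sqrt p\<close>, which gives \<open>|A| \<le> (2 n)\<^sup>n sqrt m\<close>
  (\<open>card_le_of_local_nonsquares\<close>). This is stronger than the claim.
\<close>

section \<open>Additive characters\<close>

definition add_char :: "nat \<Rightarrow> int \<Rightarrow> complex"
  where "add_char p x = cis (2 * pi * (real_of_int x / real p))"

lemma add_char_0 [simp]: "add_char p 0 = 1"
  by (simp add: add_char_def)

lemma add_char_add: "add_char p (x + y) = add_char p x * add_char p y"
  by (simp add: add_char_def cis_mult add_divide_distrib distrib_left)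

lemma add_char_diff: "add_char p (x - y) = add_char p x * cnj (add_char p y)"
  by (simp add: add_char_def cis_mult cis_cnj diff_divide_distrib right_diff_distrib)

lemma add_char_power: "add_char p x ^ k = add_char p (int k * x)"
  by (induction k) (simp_all add: add_char_add distrib_right)

lemma add_char_eq_1_iff:
  assumes "p > 0"
  shows "add_char p x = 1 \<longleftrightarrow> int p dvd x"
proof -
  have "add_char p x = 1 \<longleftrightarrow> (\<exists>n. real_of_int x = real_of_int (int p * n))"
    using assms by (auto simp: add_char_def cis_eq_1_iff field_simps)
  also have "\<dots> \<longleftrightarrow> int p dvd x"
    by (simp only: of_int_eq_iff dvd_def)
  finally show ?thesis .
qed

lemma add_char_cong:
  assumes "p > 0" and "int p dvd x - y"
  shows "add_char p x = add_char p y"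
  using assms add_char_add[of p "x - y" y] by (simp add: add_char_eq_1_iff)

lemma sum_add_char:
  assumes "p > 0"
  shows "(\<Sum>t<p. add_char p (int t * x)) = (if int p dvd x then of_nat p else 0)"
proof (cases "int p dvd x")
  case True
  then have "add_char p (int t * x) = 1" for t
    using assms by (simp add: add_char_eq_1_iff)
  with True show ?thesis by simp
next
  case False
  have "add_char p x ^ p = 1"
    using assms by (simp add: add_char_power add_char_eq_1_iff)
  then show ?thesis
    using False assms by (simp add: add_char_power [symmetric] add_char_eq_1_iff geometric_sum)
qed

section \<open>Quadratic Gauss sums\<close>

lemma sum_periodic_shift:
  fixes g :: "int \<Rightarrow> 'a :: ab_group_add"
  assumes "\<And>x. g (x + int p) = g x"
  shows "(\<Sum>y<p. g (int y + int z)) = (\<Sum>y<p. g (int y))"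
proof (induction z)
  case (Suc z)
  have "(\<Sum>y<p. g (int y + int (Suc z))) = (\<Sum>y<p. g (int (Suc y) + int z))"
    by (simp add: algebra_simps)
  also have "\<dots> = (\<Sum>y<Suc p. g (int y + int z)) - g (int z)"
    by (subst sum.lessThan_Suc_shift) simp
  also have "\<dots> = (\<Sum>y<p. g (int y + int z))"
    using assms[of "int z"] by (simp add: add.commute)
  finally show ?case
    using Suc.IH by simp
qed simp

definition quad_gauss_sum :: "nat \<Rightarrow> int \<Rightarrow> complex"
  where "quad_gauss_sum p t = (\<Sum>y<p. add_char p (t * (int y)\<^sup>2))"

lemma quad_gauss_sum_dvd:
  assumes "p > 0" and "int p dvd t"
  shows "quad_gauss_sum p t = of_nat p"
proof -
  have "add_char p (t * (int y)\<^sup>2) = 1" for y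
    using assms by (simp add: add_char_eq_1_iff)
  then show ?thesis by (simp add: quad_gauss_sum_def)
qed

text \<open>
  Weyl differencing: in the double sum for the squared modulus, the substitution \<open>y = z + h\<close> makes
  the exponent \<open>t ((z + h)\<^sup>2 - z\<^sup>2)\<close> linear in \<open>z\<close> with slope \<open>2 t h\<close>. Orthogonality leaves only
  \<open>h = 0\<close>; oddness of \<open>p\<close> enters through the factor 2.
\<close>
lemma norm_quad_gauss_sum:
  assumes "prime p" and "odd p" and "\<not> int p dvd t"
  shows "norm (quad_gauss_sum p t) = sqrt (real p)"
proof -
  have p: "p > 0" using assms(1) by (simp add: prime_gt_0_nat)
  have dvd: "int p dvd 2 * t * int h \<longleftrightarrow> h = 0" if "h < p" for h
  proof -
    have "prime (int p)" using assms(1) by simp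
    moreover have "\<not> int p dvd 2"
      using assms(1,2) by (metis dvd_refl int_dvd_int_iff of_nat_numeral primes_dvd_imp_eq two_is_prime_nat)
    ultimately show ?thesis
      using assms(3) that by (auto simp: prime_dvd_mult_iff dest: zdvd_not_zless)
  qed
  let ?S = "quad_gauss_sum p t"
  have "?S * cnj ?S = (\<Sum>y<p. \<Sum>z<p. add_char p (t * (int y)\<^sup>2 - t * (int z)\<^sup>2))"
    by (simp add: quad_gauss_sum_def sum_product add_char_diff)
  also have "\<dots> = (\<Sum>z<p. \<Sum>y<p. add_char p (t * (int y)\<^sup>2 - t * (int z)\<^sup>2))"
    by (rule sum.swap)
  also have "\<dots> = (\<Sum>z<p. \<Sum>h<p. add_char p (t * (int h + int z)\<^sup>2 - t * (int z)\<^sup>2))"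
  proof (rule sum.cong[OF refl])
    fix z
    have "add_char p (t * (x + int p)\<^sup>2 - t * (int z)\<^sup>2) = add_char p (t * x\<^sup>2 - t * (int z)\<^sup>2)" for x
      using p by (intro add_char_cong) (auto simp: power2_eq_square algebra_simps)
    from sum_periodic_shift[of "\<lambda>x. add_char p (t * x\<^sup>2 - t * (int z)\<^sup>2)", OF this, of z]
    show "(\<Sum>y<p. add_char p (t * (int y)\<^sup>2 - t * (int z)\<^sup>2)) =
          (\<Sum>h<p. add_char p (t * (int h + int z)\<^sup>2 - t * (int z)\<^sup>2))" by simp
  qed
  also have "\<dots> = (\<Sum>h<p. \<Sum>z<p. add_char p (t * (int h + int z)\<^sup>2 - t * (int z)\<^sup>2))"
    by (rule sum.swap)
  also have "\<dots> = (\<Sum>h<p. add_char p (t * (int h)\<^sup>2) * (\<Sum>z<p. add_char p (int z * (2 * t * int h))))"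
    unfolding sum_distrib_left add_char_add [symmetric]
    by (intro sum.cong refl arg_cong[where f = "add_char p"]) (simp add: power2_eq_square algebra_simps)
  also have "\<dots> = (\<Sum>h<p. if h = 0 then of_nat p else 0)"
    by (intro sum.cong refl) (auto simp: sum_add_char[OF p] dvd)
  also have "\<dots> = of_nat p"
    using p by simp
  finally have "complex_of_real ((norm ?S)\<^sup>2) = complex_of_real (real p)"
    by (simp only: complex_norm_square of_real_of_nat_eq)
  then have "(norm ?S)\<^sup>2 = real p" by (simp only: of_real_eq_iff)
  then show ?thesis by (metis norm_ge_zero real_sqrt_unique)
qed

section \<open>A weight supported on the squares modulo a prime\<close>

text \<open>
  Counting square roots, in place of a Legendre symbol, makes the Fourier coefficients quadratic
  Gauss sums by definition. The extra mass \<open>c\<close> at 0 adds the same constant to every coefficient.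
\<close>
definition sqrt_weight :: "nat \<Rightarrow> real \<Rightarrow> int \<Rightarrow> real"
  where "sqrt_weight p c x =
    (if int p dvd x then c else 0) + real (card {y. y < p \<and> int p dvd (int y)\<^sup>2 - x})"

lemma sqrt_weight_eq_0:
  assumes "\<not> (\<exists>y. int p dvd y\<^sup>2 - x)"
  shows "sqrt_weight p c x = 0"
proof -
  have "\<not> int p dvd x" using assms[simplified, rule_format, of 0] by simp
  then show ?thesis using assms by (auto simp: sqrt_weight_def)
qed

lemma sqrt_weight_0:
  assumes "prime p"
  shows "sqrt_weight p c 0 = c + 1"
proof -
  have "{y. y < p \<and> int p dvd (int y)\<^sup>2 - 0} = {0}"
    using assms by (auto simp: prime_gt_0_nat prime_dvd_power_iff simp flip: of_nat_power dest: nat_dvd_not_less)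
  then show ?thesis by (simp add: sqrt_weight_def)
qed

lemma sqrt_weight_fourier:
  assumes p: "p > 0"
  shows "complex_of_real (sqrt_weight p c x) =
    (\<Sum>t<p. (of_real c + quad_gauss_sum p (- int t)) / of_nat p * add_char p (int t * x))"
proof -
  have gauss: "(\<Sum>t<p. quad_gauss_sum p (- int t) * add_char p (int t * x)) =
      of_nat p * of_nat (card {y. y < p \<and> int p dvd (int y)\<^sup>2 - x})"
  proof -
    have "(\<Sum>t<p. quad_gauss_sum p (- int t) * add_char p (int t * x)) =
        (\<Sum>t<p. \<Sum>y<p. add_char p (int t * (x - (int y)\<^sup>2)))"
      unfolding quad_gauss_sum_def sum_distrib_right add_char_add [symmetric]
      by (simp add: algebra_simps)
    also have "\<dots> = (\<Sum>y<p. \<Sum>t<p. add_char p (int t * (x - (int y)\<^sup>2)))"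
      by (rule sum.swap)
    also have "\<dots> = (\<Sum>y<p. if int p dvd (int y)\<^sup>2 - x then of_nat p else 0)"
      by (simp add: sum_add_char[OF p] dvd_diff_commute)
    also have "\<dots> = of_nat p * of_nat (card {y. y < p \<and> int p dvd (int y)\<^sup>2 - x})"
      by (subst sum.If_cases) (auto simp: Int_def mult.commute)
    finally show ?thesis .
  qed
  have "(\<Sum>t<p. (of_real c + quad_gauss_sum p (- int t)) / of_nat p * add_char p (int t * x)) =
      (of_real c * (\<Sum>t<p. add_char p (int t * x)) +
       (\<Sum>t<p. quad_gauss_sum p (- int t) * add_char p (int t * x))) / of_nat p"
    by (simp add: sum_distrib_left add_divide_distrib distrib_right sum.distrib sum_divide_distrib)
  also have "\<dots> = complex_of_real (sqrt_weight p c x)"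
    unfolding gauss sum_add_char[OF p] using p by (simp add: sqrt_weight_def field_simps)
  finally show ?thesis ..
qed

section \<open>Products of complex numbers near the positive axis\<close>

text \<open>
  The deviation of \<open>\<Prod>(1 + w\<^sub>i)\<close> from 1 is at most \<open>\<Prod>(1 + |w\<^sub>i|) - 1\<close>. The tolerance
  \<open>1 / (2 |I|)\<close> bounds the latter product by \<open>exp (1/2) \<le> 2\<close>.
\<close>
lemma Re_prod_nonneg:
  fixes r :: "nat \<Rightarrow> real" and w :: "nat \<Rightarrow> complex"
  assumes "finite I" and r: "\<And>i. i \<in> I \<Longrightarrow> r i \<ge> 0"
    and w: "\<And>i. i \<in> I \<Longrightarrow> norm (w i) \<le> 1 / (2 * real (card I))"
  shows "Re (\<Prod>i\<in>I. of_real (r i) * (1 + w i)) \<ge> 0"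
proof -
  have "(\<Prod>i\<in>I. 1 + norm (w i)) \<le> (\<Prod>i\<in>I. exp (1 / (2 * real (card I))))"
  proof (rule prod_mono)
    fix i assume "i \<in> I"
    then show "0 \<le> 1 + norm (w i) \<and> 1 + norm (w i) \<le> exp (1 / (2 * real (card I)))"
      using w[of i] exp_ge_add_one_self[of "1 / (2 * real (card I))"]
      by (intro conjI add_nonneg_nonneg norm_ge_zero zero_le_one) linarith
  qed
  also have "\<dots> \<le> 2"
    using exp_half_le2 by (cases "card I = 0") (simp_all add: exp_of_nat_mult [symmetric])
  finally have "norm ((\<Prod>i\<in>I. 1 + w i) - 1) \<le> 1"
    using norm_prod_minus1_le_prod_minus1[of w I] by linarith
  then have "Re (\<Prod>i\<in>I. 1 + w i) \<ge> 0"
    using abs_Re_le_cmod[of "(\<Prod>i\<in>I. 1 + w i) - 1"] by simp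
  moreover have "(\<Prod>i\<in>I. of_real (r i) * (1 + w i)) = of_real (\<Prod>i\<in>I. r i) * (\<Prod>i\<in>I. 1 + w i)"
    by (simp add: prod.distrib)
  ultimately show ?thesis
    using r by (simp add: prod_nonneg del: of_real_prod)
qed

section \<open>Squares modulo a squarefree number\<close>

lemma exists_square_root_mod_squarefree:
  fixes m :: nat and x :: int
  assumes "squarefree m" and m: "m > 0"
    and roots: "\<And>p. prime p \<Longrightarrow> p dvd m \<Longrightarrow> \<exists>y. int p dvd y\<^sup>2 - x"
  shows "\<exists>y. int m dvd y\<^sup>2 - x"
proof -
  let ?P = "prime_factors m"
  have m_eq: "m = \<Prod>?P"
  proof -
    have "m = (\<Prod>p\<in>?P. p ^ multiplicity p m)"
      using m by (simp add: prod_prime_factors)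
    also have "\<dots> = \<Prod>?P"
      using assms(1) m by (intro prod.cong) (auto simp: squarefree_factorial_semiring' in_prime_factors_iff)
    finally show ?thesis .
  qed
  \<comment> \<open>The Chinese remainder theorem is used for natural numbers, so nonnegative roots are chosen.\<close>
  have "\<exists>y. int p dvd (int y)\<^sup>2 - x" if p: "p \<in> ?P" for p
  proof -
    obtain y where "int p dvd y\<^sup>2 - x" using roots[of p] p by auto
    moreover have "int p > 0" using p by (simp add: in_prime_factors_iff prime_gt_0_nat)
    moreover have "[y = y mod int p] (mod int p)" by simp
    then have "[y\<^sup>2 - x = (y mod int p)\<^sup>2 - x] (mod int p)"
      by (intro cong_diff cong_pow cong_refl)
    ultimately show ?thesis
      by (intro exI[of _ "nat (y mod int p)"]) (simp add: cong_dvd_iff)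
  qed
  then obtain u where u: "\<And>p. p \<in> ?P \<Longrightarrow> int p dvd (int (u p))\<^sup>2 - x" by metis
  have cop: "\<forall>p\<in>?P. \<forall>q\<in>?P. p \<noteq> q \<longrightarrow> coprime p q"
    by (auto intro: primes_coprime)
  then obtain y where y: "\<And>p. p \<in> ?P \<Longrightarrow> [y = u p] (mod p)"
    using chinese_remainder_nat[of ?P "\<lambda>p. p" u] by auto
  have "[(int y)\<^sup>2 = x] (mod (\<Prod>p\<in>?P. int p))"
  proof (intro cong_cong_prod_coprime ballI impI)
    fix p assume p: "p \<in> ?P"
    have "[int y = int (u p)] (mod int p)" using y[OF p] by (simp add: cong_int_iff)
    then have "[(int y)\<^sup>2 = (int (u p))\<^sup>2] (mod int p)" by (rule cong_pow)
    also have "[(int (u p))\<^sup>2 = x] (mod int p)" using u[OF p] by (simp add: cong_iff_dvd_diff)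
    finally show "[(int y)\<^sup>2 = x] (mod int p)" .
  qed (use cop in auto)
  moreover have "(\<Prod>p\<in>?P. int p) = int m" using m_eq by (simp flip: of_nat_prod)
  ultimately show ?thesis by (auto simp: cong_iff_dvd_diff)
qed
section \<open>The bound\<close>

text \<open>
  The frequencies are indexed by tuples \<open>\<tau>\<close> with one residue for each prime, because the product of
  the local Fourier expansions unfolds into a sum over such tuples. The corresponding characters
  \<open>chi \<tau>\<close> of the integers are products of local ones, so that a character modulo \<open>\<Prod>P\<close> never has to be
  identified.
\<close>
lemma card_le_of_local_nonsquares:
  fixes A :: "int set" and P :: "nat set"
  assumes A: "finite A" and P: "finite P"
    and prime: "\<And>p. p \<in> P \<Longrightarrow> prime p" and odd: "\<And>p. p \<in> P \<Longrightarrow> odd p"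
    and nonsquare: "\<And>a b. a \<in> A \<Longrightarrow> b \<in> A \<Longrightarrow> a \<noteq> b \<Longrightarrow>
      \<exists>p\<in>P. \<not> (\<exists>y. int p dvd y\<^sup>2 - (a - b))"
  shows "real (card A) \<le> (2 * real (card P)) ^ card P * sqrt (real (\<Prod>P))"
proof -
  define k where "k = 2 * real (card P)"
  define c where "c p = k * sqrt (real p)" for p
  define u where "u p t = (complex_of_real (c p) + quad_gauss_sum p (- int t)) / of_nat p" for p t
  define T where "T = (\<Pi>\<^sub>E p\<in>P. {..<p})"
  define chi where "chi \<tau> x = (\<Prod>p\<in>P. add_char p (int (\<tau> p) * x))" for \<tau> x
  define U where "U \<tau> = (\<Prod>p\<in>P. u p (\<tau> p))" for \<tau>
  define F where "F x = (\<Prod>p\<in>P. complex_of_real (sqrt_weight p (c p) x))" for x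
  define D where "D = (\<Prod>p\<in>P. c p + 1)"
  define E where "E = (\<Prod>p\<in>P. (c p + real p) / real p)"
  define \<tau>0 where "\<tau>0 = restrict (\<lambda>_. 0::nat) P"
  have pos: "p > 0" if "p \<in> P" for p using prime[OF that] by (rule prime_gt_0_nat)
  have k: "k \<ge> 2" if "p \<in> P" for p
  proof -
    have "card P \<ge> 1" using that P by (simp add: Suc_le_eq card_gt_0_iff) auto
    then show ?thesis by (simp add: k_def)
  qed
  have c_pos: "c p > 0" if "p \<in> P" for p
    using k[OF that] pos[OF that] by (simp add: c_def)
  have finite_T: "finite T" unfolding T_def using P by (intro finite_PiE) auto
  have \<tau>0: "\<tau>0 \<in> T" using pos by (auto simp: \<tau>0_def T_def)

  have F_fourier: "F x = (\<Sum>\<tau>\<in>T. U \<tau> * chi \<tau> x)" for x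
  proof -
    have "F x = (\<Prod>p\<in>P. \<Sum>t<p. u p t * add_char p (int t * x))"
      unfolding F_def u_def by (intro prod.cong refl sqrt_weight_fourier pos)
    also have "\<dots> = (\<Sum>\<tau>\<in>T. \<Prod>p\<in>P. u p (\<tau> p) * add_char p (int (\<tau> p) * x))"
      unfolding T_def using P by (intro prod_sum_PiE) auto
    finally show ?thesis by (simp add: U_def chi_def prod.distrib)
  qed
  have F_0: "F 0 = of_real D"
    unfolding F_def D_def of_real_prod
    by (intro prod.cong refl) (simp add: sqrt_weight_0 prime)
  have F_diff: "F (a - b) = 0" if ab: "a \<in> A" "b \<in> A" "a \<noteq> b" for a b
  proof -
    obtain p where "p \<in> P" "\<not> (\<exists>y. int p dvd y\<^sup>2 - (a - b))" using nonsquare[OF ab] by blast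
    then show ?thesis
      unfolding F_def using P sqrt_weight_eq_0[of p "a - b" "c p"]
      by (intro prod_zero) (auto intro!: bexI[of _ p])
  qed
  have chi_diff: "chi \<tau> (a - b) = chi \<tau> a * cnj (chi \<tau> b)" for \<tau> a b
    by (simp add: chi_def right_diff_distrib add_char_diff prod.distrib)

  \<comment> \<open>Evaluate \<open>\<Sum>a b. F (a - b)\<close> twice: only the diagonal survives in physical space, and in
    Fourier space each \<open>\<tau>\<close> contributes \<open>U \<tau>\<close> times a squared modulus.\<close>
  have "of_real (real (card A) * D) = (\<Sum>a\<in>A. \<Sum>b\<in>A. if b = a then complex_of_real D else 0)"
    using A by simp
  also have "\<dots> = (\<Sum>a\<in>A. \<Sum>b\<in>A. F (a - b))"
    by (intro sum.cong refl) (auto simp: F_0 F_diff)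
  also have "\<dots> = (\<Sum>a\<in>A. \<Sum>b\<in>A. \<Sum>\<tau>\<in>T. U \<tau> * (chi \<tau> a * cnj (chi \<tau> b)))"
    by (simp add: F_fourier chi_diff)
  also have "\<dots> = (\<Sum>a\<in>A. \<Sum>\<tau>\<in>T. \<Sum>b\<in>A. U \<tau> * (chi \<tau> a * cnj (chi \<tau> b)))"
    by (intro sum.cong refl sum.swap)
  also have "\<dots> = (\<Sum>\<tau>\<in>T. \<Sum>a\<in>A. \<Sum>b\<in>A. U \<tau> * (chi \<tau> a * cnj (chi \<tau> b)))"
    by (rule sum.swap)
  also have "\<dots> = (\<Sum>\<tau>\<in>T. U \<tau> * ((\<Sum>a\<in>A. chi \<tau> a) * cnj (\<Sum>a\<in>A. chi \<tau> a)))"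
    by (simp only: cnj_sum sum_product) (simp only: sum_distrib_left)
  also have "\<dots> = (\<Sum>\<tau>\<in>T. U \<tau> * of_real ((norm (\<Sum>a\<in>A. chi \<tau> a))\<^sup>2))"
    by (simp only: complex_norm_square)
  finally have "Re (of_real (real (card A) * D)) =
      Re (\<Sum>\<tau>\<in>T. U \<tau> * of_real ((norm (\<Sum>a\<in>A. chi \<tau> a))\<^sup>2))"
    by (rule arg_cong)
  then have count: "real (card A) * D = (\<Sum>\<tau>\<in>T. Re (U \<tau>) * (norm (\<Sum>a\<in>A. chi \<tau> a))\<^sup>2)"
    by simp

  have Re_U: "Re (U \<tau>) \<ge> 0" for \<tau>
  proof -
    \<comment> \<open>A trivial local frequency contributes the positive number \<open>(c p + p) / p\<close> exactly; at the others
      the Gauss sum is a perturbation of \<open>c p\<close> of relative size \<open>1 / k\<close>.\<close>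
    define S where "S p = quad_gauss_sum p (- int (\<tau> p))" for p
    define r where "r p = (if int p dvd int (\<tau> p) then (c p + real p) / real p else c p / real p)" for p
    define w where "w p = (if int p dvd int (\<tau> p) then 0 else S p / of_real (c p))" for p
    have S0: "S p = of_nat p" if "p \<in> P" "int p dvd int (\<tau> p)" for p
      using that pos unfolding S_def by (intro quad_gauss_sum_dvd) auto
    have "u p (\<tau> p) = of_real (r p) * (1 + w p)" if "p \<in> P" for p
      using S0[OF that] c_pos[OF that]
      by (simp add: u_def S_def [symmetric] r_def w_def field_simps add_divide_distrib)
    then have "U \<tau> = (\<Prod>p\<in>P. of_real (r p) * (1 + w p))"
      by (simp add: U_def)
    moreover have "Re (\<Prod>p\<in>P. of_real (r p) * (1 + w p)) \<ge> 0"
    proof (rule Re_prod_nonneg[OF P])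
      fix p assume p: "p \<in> P"
      show "r p \<ge> 0" using c_pos[OF p] by (simp add: r_def)
      show "norm (w p) \<le> 1 / (2 * real (card P))"
      proof (cases "int p dvd int (\<tau> p)")
        case False
        then have "norm (S p) = sqrt (real p)"
          unfolding S_def using p by (intro norm_quad_gauss_sum prime odd) auto
        then have "norm (w p) = 1 / k"
          using False pos[OF p] k[OF p] by (simp add: w_def norm_divide norm_mult c_def del: int_dvd_int_iff)
        then show ?thesis by (simp add: k_def)
      qed (simp add: w_def)
    qed
    ultimately show ?thesis by simp
  qed
  \<comment> \<open>\<open>\<tau>0\<close> is the trivial frequency, and \<open>E\<close> is the mean of \<open>F\<close>.\<close>
  have "U \<tau>0 = of_real E"
    unfolding U_def E_def of_real_prod
    by (intro prod.cong refl) (simp add: u_def \<tau>0_def quad_gauss_sum_dvd pos)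
  moreover have "chi \<tau>0 a = 1" for a
    by (simp add: chi_def \<tau>0_def)
  ultimately have "E * (real (card A))\<^sup>2 = Re (U \<tau>0) * (norm (\<Sum>a\<in>A. chi \<tau>0 a))\<^sup>2"
    by simp
  also have "\<dots> \<le> real (card A) * D"
    unfolding count using Re_U by (intro member_le_sum[OF \<tau>0 _ finite_T]) simp
  finally have main: "E * real (card A) \<le> D"
    using A by (cases "card A = 0")
      (auto simp: power2_eq_square D_def intro!: prod_nonneg dest: c_pos less_imp_le)

  have sqrt_prod: "sqrt (\<Prod>p\<in>P. real p) = (\<Prod>p\<in>P. sqrt (real p))"
    using P by (induction P) (simp_all add: real_sqrt_mult)
  have "D \<le> (\<Prod>p\<in>P. (c p + real p) / real p * (k * sqrt (real p)))"
    unfolding D_def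
  proof (rule prod_mono)
    fix p assume p: "p \<in> P"
    have "(c p + real p) / real p * (k * sqrt (real p)) = k\<^sup>2 + c p"
      using pos[OF p] by (simp add: c_def field_simps power2_eq_square)
    moreover have "1 \<le> k\<^sup>2" using k[OF p] by (simp add: one_le_power)
    ultimately show "0 \<le> c p + 1 \<and> c p + 1 \<le> (c p + real p) / real p * (k * sqrt (real p))"
      using c_pos[OF p] by linarith
  qed
  also have "\<dots> = E * (k ^ card P * sqrt (real (\<Prod>P)))"
    by (simp only: E_def prod.distrib of_nat_prod sqrt_prod prod_constant)
  finally have "E * real (card A) \<le> E * (k ^ card P * sqrt (real (\<Prod>P)))"
    using main by simp
  moreover have "E > 0"
    unfolding E_def using c_pos pos by (intro prod_pos) (simp add: add_pos_pos)
  ultimately show ?thesis by (simp add: k_def)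
qed

lemma square_in_residue_ring_iff:
  assumes "m > 0" and "x \<in> carrier (residue_ring m)"
  shows "square_in (residue_ring m) x \<longleftrightarrow> (\<exists>y. m dvd y\<^sup>2 - x)"
proof
  assume "square_in (residue_ring m) x"
  then obtain y where "x = y * y mod m"
    by (auto simp: square_in_def residue_ring_def)
  then show "\<exists>y. m dvd y\<^sup>2 - x"
    by (intro exI[of _ y]) (simp add: power2_eq_square mod_eq_dvd_iff [symmetric])
next
  assume "\<exists>y. m dvd y\<^sup>2 - x"
  then obtain y where "m dvd y\<^sup>2 - x" ..
  then have "y\<^sup>2 mod m = x mod m" by (simp add: mod_eq_dvd_iff)
  moreover have "x mod m = x" using assms by (simp add: residue_ring_def)
  ultimately have "x = (y mod m) * (y mod m) mod m"
    by (simp add: power2_eq_square mod_mult_eq)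
  then show "square_in (residue_ring m) x"
    unfolding square_in_def
    by (intro bexI[of _ "y mod m"]) (use assms(1) in \<open>auto simp: residue_ring_def\<close>)
qed

lemma power_le_bound_factor: "(2 * real n) ^ n \<le> bound_factor n"
proof (cases "n = 0")
  case False
  have "(2 * real n) ^ n \<le> (3 * real n) ^ n"
    by (intro power_mono) auto
  also have "\<dots> = (3 * real n) powr real n"
    using False by (simp add: powr_realpow)
  also have "\<dots> \<le> (3 * real n) powr (1.5 * real n)"
    using False by (intro powr_mono) auto
  finally show ?thesis using False by (simp add: bound_factor_def)
qed (simp add: bound_factor_def)

theorem mainTheorem1:
  fixes m n :: nat and A :: "int set"
  assumes "m > 0" and "squarefree m"
    and "n = num_odd_prime_divisors m"
    and "A \<subseteq> carrier (residue_ring (int m))"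
    and "\<forall>x \<in> diff_set (residue_ring (int m)) A.
           square_in (residue_ring (int m)) x \<longrightarrow> x = \<zero>\<^bsub>residue_ring (int m)\<^esub>"
  shows "real (card A) \<le> real m powr (1/2) * bound_factor n"
proof -
  define P where "P = {p. prime p \<and> odd p \<and> p dvd m}"
  have P_sub: "P \<subseteq> prime_factors m"
    using assms(1) by (auto simp: P_def in_prime_factors_iff)
  then have P: "finite P" by (rule finite_subset) simp
  have n: "n = card P" using assms(3) by (simp add: num_odd_prime_divisors_def P_def)
  have carrier: "carrier (residue_ring (int m)) = {0..int m - 1}"
    by (simp add: residue_ring_def)
  have "finite A" using assms(4) unfolding carrier by (rule finite_subset) simp
  then have "real (card A) \<le> (2 * real (card P)) ^ card P * sqrt (real (\<Prod>P))"
    using P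
  proof (rule card_le_of_local_nonsquares)
    fix a b assume ab: "a \<in> A" "b \<in> A" "a \<noteq> b"
    let ?x = "(a - b) mod int m"
    have x: "?x \<in> carrier (residue_ring (int m))" using assms(1) by (simp add: carrier)
    have "?x \<in> diff_set (residue_ring (int m)) A"
      using residue_ring_minus[of "int m" a b] ab assms(1,4) by (force simp: diff_set_def)
    moreover have "?x \<noteq> 0"
    proof
      assume "?x = 0"
      then have "int m dvd a - b" by (simp add: mod_eq_0_iff_dvd)
      then have "a mod int m = b mod int m" by (simp add: mod_eq_dvd_iff)
      moreover have "a mod int m = a" "b mod int m = b"
        using ab assms(4) by (auto simp: carrier)
      ultimately show False using ab by simp
    qed
    ultimately have "\<not> square_in (residue_ring (int m)) ?x"
      using assms(5) by (auto simp: residue_ring_def)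
    then have *: "\<not> (\<exists>y. int m dvd y\<^sup>2 - ?x)"
      using square_in_residue_ring_iff[OF _ x] assms(1) by simp
    have "\<not> (\<exists>y. int m dvd y\<^sup>2 - (a - b))"
    proof
      assume "\<exists>y. int m dvd y\<^sup>2 - (a - b)"
      then obtain y where "int m dvd y\<^sup>2 - (a - b)" ..
      moreover have "y\<^sup>2 - ?x = (y\<^sup>2 - (a - b)) + ((a - b) - ?x)" by simp
      moreover have "int m dvd (a - b) - ?x" by (rule dvd_minus_mod)
      ultimately have "int m dvd y\<^sup>2 - ?x" by (metis dvd_add)
      with * show False by blast
    qed
    then obtain p where p: "prime p" "p dvd m" "\<not> (\<exists>y. int p dvd y\<^sup>2 - (a - b))"
      using exists_square_root_mod_squarefree[OF assms(2,1)] by blast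
    moreover have "odd p"
    proof
      assume "even p"
      then have "p = 2" using p(1) by (metis primes_dvd_imp_eq two_is_prime_nat)
      \<comment> \<open>Every element is its own square root modulo 2.\<close>
      moreover have "even ((a - b)\<^sup>2 - (a - b))" by simp
      ultimately show False using p(3) by (metis of_nat_numeral)
    qed
    ultimately show "\<exists>p\<in>P. \<not> (\<exists>y. int p dvd y\<^sup>2 - (a - b))" by (auto simp: P_def)
  qed (auto simp: P_def)
  also have "\<dots> \<le> bound_factor n * sqrt (real m)"
  proof (rule mult_mono)
    have "\<Prod>P dvd (\<Prod>p\<in>prime_factors m. p)"
      using P_sub by (intro prod_dvd_prod_subset) auto
    also have "\<dots> dvd (\<Prod>p\<in>prime_factors m. p ^ multiplicity p m)"
      by (intro prod_dvd_prod dvd_power) (auto simp: prime_factors_multiplicity)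
    also have "\<dots> = m" using assms(1) by (simp add: prod_prime_factors)
    finally show "sqrt (real (\<Prod>P)) \<le> sqrt (real m)"
      using assms(1) by (simp add: dvd_imp_le del: of_nat_prod)
  qed (use power_le_bound_factor[of n] in \<open>auto simp: n bound_factor_def simp del: of_nat_prod\<close>)
  finally show ?thesis
    using assms(1) by (simp add: powr_half_sqrt mult.commute)
qed

end
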